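(* Let $V$ be a probability mass function on $\mathbb{Z}_+=\{0,1,2,\dots\}$ and $c>0$. Suppose that for all functions $f:\mathbb{Z}_+\to(0,\infty)$ with $\sum_xV(x)f(x)<\infty$, $$\mathrm{Ent}_V(f)\le\frac1c\sum_{x=0}^\infty V(x)\,f(x+1)\left(\log\left(\frac{f(x+1)}{f(x)}\right)-1+\frac{f(x)}{f(x+1)}\right).$$ Write $h(s)=(1+s)\log(1+s)-s$. Then for any function $g:\mathbb{Z}_+\to\mathbb{R}$ with $\sup_x|g(x+1)-g(x)|\le1$ and any $t\ge0$, $$V\bigl(\{x: g(x)\ge \mathbb{E}_Vg+t\}\bigr)\le\exp\left(-\frac{h(ct)}{c}\right).$$
   Context: For $f:\mathbb{Z}_+\to(0,\infty)$ with $\mu_{V,f}=\sum_{x=0}^\infty V(x)f(x)<\infty$, $$\mathrm{Ent}_V(f)=\sum_{x=0}^\infty V(x)f(x)\log f(x)-\mu_{V,f}\log\mu_{V,f}\in[0,\infty].$$ Also $\mathbb{E}_Vg=\sum_{x=0}^\infty V(x)g(x)$, and $V(A)=\sum_{x\in A}V(x)$ for $A\subseteq\mathbb{Z}_+$. The right-hand side of the assumed inequality is a series of non-negative terms, valued in $[0,\infty]$. *)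

theory Defs
  imports "HOL-Probability.Probability"
begin

text \<open>A probability mass function on the non-negative integers is an element of \<^typ>\<open>nat pmf\<close>.\<close>

text \<open>The expectation as a series. It is meaningful only where the series converges.\<close>

definition E :: "nat pmf \<Rightarrow> (nat \<Rightarrow> real) \<Rightarrow> real" where
  "E V g = (\<Sum>x. pmf V x * g x)"

text \<open>The entropy takes values in $[0,\infty]$, so its series is summed in \<^typ>\<open>ereal\<close>: it is
  the limit of the partial sums, which may be \<open>\<infinity>\<close>. For positive \<open>f\<close> this limit exists, because
  \<open>u * ln u \<ge> - exp (- 1)\<close> bounds the negative part of the series by \<open>exp (- 1)\<close>.
  The mean \<open>E V f\<close> is assumed to be finite wherever \<open>Ent V f\<close> is used.\<close>

definition Ent :: "nat pmf \<Rightarrow> (nat \<Rightarrow> real) \<Rightarrow> ereal" where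
  "Ent V f = (\<Sum>x. ereal (pmf V x * f x * ln (f x))) - ereal (E V f * ln (E V f))"

definition h :: "real \<Rightarrow> real" where
  "h s = (1 + s) * ln (1 + s) - s"

end

theory Submission
  imports Defs
begin

text \<open>The proof is the Herbst argument. The assumed inequality, applied to
  \<open>f = exp (\<theta> * g)\<close>, bounds the entropy of \<open>f\<close> by
  \<open>(\<theta> * exp \<theta> - exp \<theta> + 1) / c\<close> times its mean, since a slope in \<open>[-1, 1]\<close> costs at most
  as much as the slope \<open>1\<close>. For \<open>\<Lambda> \<theta> = ln (E V (\<lambda>x. exp (\<theta> * g x)))\<close> this is the differential
  inequality \<open>\<theta> * \<Lambda>' \<theta> - \<Lambda> \<theta> \<le> (\<theta> * exp \<theta> - exp \<theta> + 1) / c\<close>. Equality holds here for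
  \<open>(exp \<theta> - 1) / c\<close>, so the difference of the two functions, divided by \<open>\<theta>\<close>, is nonincreasing,
  and comparison with its limit at \<open>0\<close> yields
  \<open>\<Lambda> \<theta> \<le> \<theta> * E V g + (exp \<theta> - 1 - \<theta>) / c\<close>. Chernoff's bound at the optimal
  \<open>\<theta> = ln (1 + c * t)\<close> is the claim.

  A Lipschitz function may have neither a mean nor exponential moments a priori. The argument is
  therefore run for the stopped functions \<open>\<lambda>x. g (min x n)\<close> (\<open>stopped_mgf_bound\<close>). They are still
  Lipschitz and take finitely many values, so that every expectation is a finite sum and can be
  differentiated freely. The resulting bound does not depend on \<open>n\<close>. For the decreasing function
  \<open>g x = - x\<close> the mean of \<open>exp (- min x n)\<close> stays away from \<open>0\<close>, which bounds the mean of
  \<open>min x n\<close> uniformly in \<open>n\<close>: hence \<open>V\<close> has a first moment (\<open>first_moment_finite\<close>). This dominates the means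
  of all stopped Lipschitz functions, and \<open>n\<close> can tend to infinity (\<open>mgf_bound\<close>).\<close>

section \<open>The cost of a slope\<close>

lemma slope_cost_nonneg: "0 \<le> u * exp u - exp u + (1::real)"
proof -
  have "1 + - u \<le> exp (- u)" by (rule exp_ge_add_one_self)
  then have "(1 + - u) * exp u \<le> exp (- u) * exp u" by (intro mult_right_mono) auto
  then show ?thesis by (simp add: exp_minus algebra_simps)
qed

text \<open>The derivative \<open>u * exp u\<close> of the cost has the sign of \<open>u\<close> and is larger in absolute value
  at \<open>\<bar>u\<bar>\<close> than at \<open>- \<bar>u\<bar>\<close>, so an upward step costs at least as much as a downward step of the same size.\<close>

lemma slope_cost_mono:
  fixes u \<theta> :: real
  assumes "\<bar>u\<bar> \<le> \<theta>"
  shows "u * exp u - exp u + 1 \<le> \<theta> * exp \<theta> - exp \<theta> + 1"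
proof -
  let ?\<phi> = "\<lambda>u::real. u * exp u - exp u + 1"
  have "?\<phi> \<bar>u\<bar> \<le> ?\<phi> \<theta>"
  proof (rule DERIV_nonneg_imp_nondecreasing[OF assms])
    fix x :: real assume "\<bar>u\<bar> \<le> x"
    then show "\<exists>y. (?\<phi> has_real_derivative y) (at x) \<and> 0 \<le> y"
      by (intro exI[of _ "x * exp x"]) (auto intro!: derivative_eq_intros)
  qed
  moreover have "?\<phi> u \<le> ?\<phi> \<bar>u\<bar>"
  proof -
    let ?d = "\<lambda>v::real. ?\<phi> v - ?\<phi> (- v)"
    have "?d 0 \<le> ?d \<bar>u\<bar>"
    proof (rule DERIV_nonneg_imp_nondecreasing[of 0])
      fix x :: real assume "0 \<le> x"
      then show "\<exists>y. (?d has_real_derivative y) (at x) \<and> 0 \<le> y"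
        by (intro exI[of _ "x * (exp x - exp (- x))"])
          (auto intro!: derivative_eq_intros mult_left_mono simp: algebra_simps)
    qed simp
    then show ?thesis by (cases "u \<ge> 0") auto
  qed
  ultimately show ?thesis by linarith
qed

section \<open>Herbst's differential inequality\<close>

text \<open>The quotient \<open>F x / x\<close> has derivative \<open>(x * F' x - F x) / x\<^sup>2\<close>, so it is nonincreasing,
  and its limit at \<open>0\<close> is \<open>F' 0\<close>.\<close>

lemma herbst_comparison:
  fixes F F' :: "real \<Rightarrow> real"
  assumes deriv: "\<And>x. (F has_real_derivative F' x) (at x)"
    and "F 0 = 0"
    and le: "\<And>x. x > 0 \<Longrightarrow> x * F' x \<le> F x"
    and "\<theta> \<ge> 0"
  shows "F \<theta> \<le> \<theta> * F' 0"
proof (cases "\<theta> = 0")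
  case False
  with \<open>\<theta> \<ge> 0\<close> have "\<theta> > 0" by simp
  have anti: "F \<theta> / \<theta> \<le> F x / x" if "0 < x" "x \<le> \<theta>" for x
  proof (rule DERIV_nonpos_imp_nonincreasing[OF \<open>x \<le> \<theta>\<close>])
    fix y assume "x \<le> y"
    with that have "y > 0" by simp
    then show "\<exists>z. ((\<lambda>x. F x / x) has_real_derivative z) (at y) \<and> z \<le> 0"
      using le[of y]
      by (intro exI[of _ "(F' y * y - F y * 1) / (y * y)"] conjI DERIV_divide deriv DERIV_ident)
        (auto simp: divide_le_0_iff mult.commute)
  qed
  have "((\<lambda>x. F x / x) \<longlongrightarrow> F' 0) (at_right 0)"
    using deriv[of 0] \<open>F 0 = 0\<close>
    by (auto simp: has_field_derivative_iff intro: filterlim_at_split[THEN iffD1, THEN conjunct2])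
  moreover have "\<forall>\<^sub>F x in at_right 0. F \<theta> / \<theta> \<le> F x / x"
    using eventually_at_right_less[of 0] eventually_at_right[OF \<open>\<theta> > 0\<close>] anti \<open>\<theta> > 0\<close>
    by (auto intro!: exI[of _ \<theta>])
  ultimately have "F \<theta> / \<theta> \<le> F' 0"
    by (intro tendsto_lowerbound) auto
  with \<open>\<theta> > 0\<close> show ?thesis by (simp add: field_simps)
qed (use \<open>F 0 = 0\<close> in simp)

text \<open>The hypothesis \<open>ent\<close> bounds the entropy of \<open>exp (\<theta> * g)\<close> under the weights \<open>w\<close>.
  Its left-hand side is \<open>M \<theta>\<close> times \<open>\<theta> * \<Lambda>' \<theta> - \<Lambda> \<theta>\<close> for \<open>\<Lambda> = ln \<circ> M\<close>.\<close>

lemma finite_herbst: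
  fixes I :: "'a set" and w g :: "'a \<Rightarrow> real" and c \<theta> :: real
  defines "M \<equiv> \<lambda>\<theta>. \<Sum>i\<in>I. w i * exp (\<theta> * g i)"
  assumes "finite I" and w: "\<And>i. i \<in> I \<Longrightarrow> w i \<ge> 0" "sum w I = 1"
    and ent: "\<And>\<theta>. \<theta> > 0 \<Longrightarrow> \<theta> * (\<Sum>i\<in>I. w i * g i * exp (\<theta> * g i)) - M \<theta> * ln (M \<theta>)
      \<le> (\<theta> * exp \<theta> - exp \<theta> + 1) / c * M \<theta>"
    and "\<theta> \<ge> 0"
  shows "M \<theta> \<le> exp (\<theta> * (\<Sum>i\<in>I. w i * g i) + (exp \<theta> - 1 - \<theta>) / c)"
proof -
  define M' where "M' = (\<lambda>\<theta>. \<Sum>i\<in>I. w i * g i * exp (\<theta> * g i))"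
  have M_pos: "M x > 0" for x
  proof -
    have "M x \<noteq> 0"
    proof
      assume "M x = 0"
      then have "\<forall>i\<in>I. w i * exp (x * g i) = 0"
        unfolding M_def using w(1) by (subst (asm) sum_nonneg_eq_0_iff[OF \<open>finite I\<close>]) auto
      then have "sum w I = 0" by simp
      with w(2) show False by simp
    qed
    moreover have "M x \<ge> 0" unfolding M_def using w(1) by (auto intro!: sum_nonneg)
    ultimately show ?thesis by simp
  qed
  have M_deriv: "(M has_real_derivative M' x) (at x)" for x
    unfolding M_def M'_def by (auto intro!: derivative_eq_intros sum.cong)
  let ?F = "\<lambda>x. ln (M x) - (exp x - 1) / c"
  let ?F' = "\<lambda>x. M' x / M x - exp x / c"
  have "M 0 = 1" unfolding M_def using w(2) by simp
  have "?F \<theta> \<le> \<theta> * ?F' 0"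
  proof (rule herbst_comparison[OF _ _ _ \<open>\<theta> \<ge> 0\<close>])
    show "(?F has_real_derivative ?F' x) (at x)" for x
      using M_pos[of x] by (auto intro!: derivative_eq_intros M_deriv simp: divide_inverse)
    show "?F 0 = 0" using \<open>M 0 = 1\<close> by simp
    show "x * ?F' x \<le> ?F x" if "x > 0" for x
    proof -
      have "(x * M' x - M x * ln (M x)) / M x \<le> (x * exp x - exp x + 1) / c"
        using ent[OF that] M_pos[of x] by (simp add: M'_def pos_divide_le_eq)
      moreover have "(x * M' x - M x * ln (M x)) / M x = x * (M' x / M x) - ln (M x)"
        using M_pos[of x] by (simp add: field_simps)
      ultimately show ?thesis by (simp add: right_diff_distrib diff_divide_distrib add_divide_distrib)
    qed
  qed
  moreover have "?F' 0 = (\<Sum>i\<in>I. w i * g i) - 1 / c"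
    using \<open>M 0 = 1\<close> by (simp add: M'_def)
  ultimately have "ln (M \<theta>) \<le> \<theta> * (\<Sum>i\<in>I. w i * g i) + (exp \<theta> - 1 - \<theta>) / c"
    by (simp only: right_diff_distrib diff_divide_distrib times_divide_eq_right mult_1_right)
  then show ?thesis
    using M_pos[of \<theta>] by (subst (asm) exp_le_cancel_iff[symmetric]) simp
qed

section \<open>Stopped functions\<close>

lemma pmf_sums_expectation:
  fixes q :: "nat \<Rightarrow> real"
  assumes "integrable (measure_pmf V) q"
  shows "(\<lambda>x. pmf V x * q x) sums measure_pmf.expectation V q"
proof -
  have "integrable (count_space UNIV) (\<lambda>x. pmf V x * q x)"
    using assms by (subst (asm) measure_pmf_eq_density) (simp add: integrable_density)
  then have "(\<lambda>x. pmf V x * q x) sums integral\<^sup>L (count_space UNIV) (\<lambda>x. pmf V x * q x)"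
    by (rule sums_integral_count_space_nat)
  then show ?thesis by (simp add: measure_pmf_eq_density integral_density)
qed

text \<open>Stopping at \<open>n\<close> moves the mass beyond \<open>n\<close> to \<open>n\<close>. The law of \<open>min x n\<close> is supported on the
  finite set \<open>{..n}\<close>, so the series reduces to a finite sum without any condition on \<open>q\<close>.\<close>

lemma stopped_sums:
  fixes q :: "nat \<Rightarrow> real"
  shows "(\<lambda>x. pmf V x * q (min x n)) sums (\<Sum>i\<le>n. pmf (map_pmf (\<lambda>x. min x n) V) i * q i)"
proof -
  let ?W = "map_pmf (\<lambda>x. min x n) V"
  have fin: "finite (set_pmf ?W)" and sub: "set_pmf ?W \<subseteq> {..n}"
    by (auto intro: finite_subset[of _ "{..n}"])
  have "integrable (measure_pmf V) (\<lambda>x. q (min x n))"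
    using integrable_measure_pmf_finite[OF fin, of q] by (simp add: integrable_map_pmf_eq)
  then have "(\<lambda>x. pmf V x * q (min x n)) sums measure_pmf.expectation V (\<lambda>x. q (min x n))"
    by (rule pmf_sums_expectation)
  moreover have "measure_pmf.expectation V (\<lambda>x. q (min x n)) = measure_pmf.expectation ?W q"
    by simp
  moreover have "measure_pmf.expectation ?W q = (\<Sum>i\<le>n. pmf ?W i * q i)"
    using sub by (subst integral_measure_pmf_real[where A="{..n}"]) (auto simp: mult.commute)
  ultimately show ?thesis by metis
qed

definition modified_log_sobolev :: "nat pmf \<Rightarrow> real \<Rightarrow> bool" where
  "modified_log_sobolev V c \<longleftrightarrow> (\<forall>f :: nat \<Rightarrow> real. (\<forall>x. f x > 0) \<longrightarrow>
    summable (\<lambda>x. pmf V x * f x) \<longrightarrow> Ent V f \<le> ereal (1 / c) *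
      (\<Sum>x. ereal (pmf V x * f (x + 1) * (ln (f (x + 1) / f x) - 1 + f x / f (x + 1)))))"

lemma Ent_eq_ereal:
  assumes "summable (\<lambda>x. pmf V x * f x * ln (f x))"
  shows "Ent V f = ereal ((\<Sum>x. pmf V x * f x * ln (f x)) - E V f * ln (E V f))"
  using suminf_ereal'[OF assms] by (simp add: Ent_def)

text \<open>For \<open>f = exp (\<theta> * g)\<close> and \<open>u = \<theta> * (g (x + 1) - g x)\<close>, the \<open>x\<close>-th term on the right of the
  log-Sobolev inequality is \<open>pmf V x * f x * (u * exp u - exp u + 1)\<close>. Since \<open>\<bar>u\<bar> \<le> \<theta>\<close>, the last
  factor is bounded by its value at \<open>\<theta>\<close>, and what remains is the series of \<open>E V f\<close>.\<close>

lemma entropy_exp_le: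
  fixes g :: "nat \<Rightarrow> real"
  assumes "c > 0" and lsi: "modified_log_sobolev V c"
    and lip: "\<And>x. \<bar>g (x + 1) - g x\<bar> \<le> 1" and "\<theta> \<ge> 0"
    and sum: "summable (\<lambda>x. pmf V x * exp (\<theta> * g x))"
    and sum_ln: "summable (\<lambda>x. pmf V x * exp (\<theta> * g x) * (\<theta> * g x))"
  shows "(\<Sum>x. pmf V x * exp (\<theta> * g x) * (\<theta> * g x))
      - E V (\<lambda>x. exp (\<theta> * g x)) * ln (E V (\<lambda>x. exp (\<theta> * g x)))
    \<le> (\<theta> * exp \<theta> - exp \<theta> + 1) / c * E V (\<lambda>x. exp (\<theta> * g x))"
proof -
  let ?f = "\<lambda>x. exp (\<theta> * g x)"
  let ?r = "\<lambda>x. pmf V x * ?f (x + 1) * (ln (?f (x + 1) / ?f x) - 1 + ?f x / ?f (x + 1))"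
  let ?b = "\<lambda>x. (\<theta> * exp \<theta> - exp \<theta> + 1) * (pmf V x * ?f x)"
  have r_bounds: "0 \<le> ?r x \<and> ?r x \<le> ?b x" for x
  proof -
    define u where "u = \<theta> * (g (x + 1) - g x)"
    have "exp u = ?f (x + 1) / ?f x"
      by (simp add: u_def right_diff_distrib exp_diff)
    then have f_Suc: "?f (x + 1) = ?f x * exp u" by simp
    have r: "?r x = pmf V x * ?f x * (u * exp u - exp u + 1)"
      unfolding f_Suc by (simp add: field_simps)
    have "\<bar>u\<bar> \<le> \<theta>"
      using mult_left_mono[OF lip[of x] \<open>\<theta> \<ge> 0\<close>] \<open>\<theta> \<ge> 0\<close> by (simp add: u_def abs_mult)
    then have "?r x \<le> pmf V x * ?f x * (\<theta> * exp \<theta> - exp \<theta> + 1)"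
      unfolding r by (intro mult_left_mono slope_cost_mono) auto
    moreover have "0 \<le> ?r x"
      unfolding r by (intro mult_nonneg_nonneg slope_cost_nonneg) auto
    ultimately show ?thesis by (simp only: mult.commute)
  qed
  have sum_b: "summable ?b" using sum by (rule summable_mult)
  have sum_r: "summable ?r"
    by (rule summable_comparison_test'[OF sum_b, of 0]) (use r_bounds in \<open>simp only: real_norm_def abs_of_nonneg\<close>)
  have "Ent V ?f \<le> ereal (1 / c) * (\<Sum>x. ereal (?r x))"
    using lsi[unfolded modified_log_sobolev_def, rule_format, of ?f] sum by simp
  also have "(\<Sum>x. ereal (?r x)) = ereal (\<Sum>x. ?r x)"
    by (rule suminf_ereal'[OF sum_r])
  finally have "(\<Sum>x. pmf V x * ?f x * (\<theta> * g x)) - E V ?f * ln (E V ?f) \<le> 1 / c * (\<Sum>x. ?r x)"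
    using sum_ln Ent_eq_ereal[of V ?f] by simp
  also have "\<dots> \<le> 1 / c * (\<Sum>x. ?b x)"
    using \<open>c > 0\<close> r_bounds by (intro mult_left_mono suminf_le sum_r sum_b) auto
  also have "(\<Sum>x. ?b x) = (\<theta> * exp \<theta> - exp \<theta> + 1) * E V ?f"
    unfolding E_def using sum by (rule suminf_mult)
  finally show ?thesis by simp
qed

lemma stopped_mgf_bound:
  fixes g :: "nat \<Rightarrow> real"
  assumes "c > 0" and "modified_log_sobolev V c"
    and lip: "\<And>x. \<bar>g (x + 1) - g x\<bar> \<le> 1" and "\<theta> \<ge> 0"
  shows "E V (\<lambda>x. exp (\<theta> * g (min x n)))
    \<le> exp (\<theta> * E V (\<lambda>x. g (min x n)) + (exp \<theta> - 1 - \<theta>) / c)"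
proof -
  define w where "w = pmf (map_pmf (\<lambda>x. min x n) V)"
  note sums = stopped_sums[of V _ n, folded w_def]
  have E_eq: "E V (\<lambda>x. q (min x n)) = (\<Sum>i\<le>n. w i * q i)" for q
    unfolding E_def by (rule sums_unique[OF sums, symmetric])
  have stopped_lip: "\<bar>g (min (x + 1) n) - g (min x n)\<bar> \<le> 1" for x
    using lip[of x] by (cases "x < n") (auto simp: min_def)
  have "(\<Sum>i\<le>n. w i * exp (\<theta> * g i))
    \<le> exp (\<theta> * (\<Sum>i\<le>n. w i * g i) + (exp \<theta> - 1 - \<theta>) / c)"
  proof (rule finite_herbst[OF _ _ _ _ \<open>\<theta> \<ge> 0\<close>])
    show "w i \<ge> 0" for i by (simp add: w_def)
    show "sum w {..n} = 1"
      unfolding w_def by (intro sum_pmf_eq_1) auto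
    fix s :: real assume "s > 0"
    have "(\<Sum>x. pmf V x * exp (s * g (min x n)) * (s * g (min x n)))
      = s * (\<Sum>i\<le>n. w i * g i * exp (s * g i))"
      using sums_unique[OF sums[of "\<lambda>i. exp (s * g i) * (s * g i)"]]
      by (simp add: sum_distrib_left mult_ac)
    then show "s * (\<Sum>i\<le>n. w i * g i * exp (s * g i))
        - (\<Sum>i\<le>n. w i * exp (s * g i)) * ln (\<Sum>i\<le>n. w i * exp (s * g i))
      \<le> (s * exp s - exp s + 1) / c * (\<Sum>i\<le>n. w i * exp (s * g i))"
      using entropy_exp_le[of c V "\<lambda>x. g (min x n)" s, OF assms(1,2) stopped_lip] \<open>s > 0\<close>
        sums_summable[OF sums[of "\<lambda>i. exp (s * g i)"]]
        sums_summable[OF sums[of "\<lambda>i. exp (s * g i) * (s * g i)"]]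
        E_eq[of "\<lambda>i. exp (s * g i)"]
      by (simp add: mult.assoc)
  qed simp
  then show ?thesis
    using E_eq[of "\<lambda>i. exp (\<theta> * g i)"] E_eq[of g] by simp
qed

section \<open>Removing the stopping\<close>

text \<open>The bound for \<open>g x = - x\<close> at \<open>\<theta> = 1\<close> reads
  \<open>E V (\<lambda>x. exp (- min x n)) \<le> exp (K - E V (\<lambda>x. min x n))\<close> with a constant \<open>K\<close>, and an atom \<open>a\<close>
  of \<open>V\<close> bounds the left-hand side from below by \<open>pmf V a * exp (- a)\<close>, whatever \<open>n\<close> is.\<close>

lemma first_moment_finite:
  assumes "c > 0" and "modified_log_sobolev V c"
  shows "summable (\<lambda>x. pmf V x * real x)"
proof -
  obtain a where a: "pmf V a > 0"
    using set_pmf_not_empty[of V] by (auto simp: pmf_positive_iff)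
  let ?K = "(exp 1 - 1 - 1) / c"
  define B where "B = ?K - ln (pmf V a * exp (- real a))"
  have mean_le: "E V (\<lambda>x. real (min x n)) \<le> B" for n
  proof -
    let ?e = "\<lambda>x. pmf V x * exp (- real (min x n))"
    have "summable ?e" and sum_min: "summable (\<lambda>x. pmf V x * real (min x n))"
      using sums_summable[OF stopped_sums[of V "\<lambda>x. exp (- real x)" n]]
        sums_summable[OF stopped_sums[of V "\<lambda>x. real x" n]] by simp_all
    then have "pmf V a * exp (- real a) \<le> (\<Sum>x. ?e x)"
      using a sum_le_suminf[of ?e "{a}"] by (force intro: order_trans[rotated])
    also have "\<dots> \<le> exp (E V (\<lambda>x. - real (min x n)) + ?K)"
      using stopped_mgf_bound[OF assms, of "\<lambda>x. - real x" 1 n] by (simp add: E_def)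
    also have "E V (\<lambda>x. - real (min x n)) = - E V (\<lambda>x. real (min x n))"
      using suminf_minus[OF sum_min] by (simp add: E_def)
    finally have "pmf V a * exp (- real a) \<le> exp (?K - E V (\<lambda>x. real (min x n)))"
      by simp
    then have "ln (pmf V a * exp (- real a)) \<le> ?K - E V (\<lambda>x. real (min x n))"
      using a by (subst exp_le_cancel_iff[symmetric]) simp
    then show ?thesis by (simp add: B_def)
  qed
  have "(\<Sum>x<n. pmf V x * real x) \<le> B" for n
  proof -
    have "(\<Sum>x<n. pmf V x * real x) = (\<Sum>x<n. pmf V x * real (min x n))"
      by (intro sum.cong) auto
    also have "\<dots> \<le> E V (\<lambda>x. real (min x n))"
      unfolding E_def using sums_summable[OF stopped_sums[of V "\<lambda>x. real x" n]]
      by (intro sum_le_suminf) auto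
    finally show ?thesis using mean_le[of n] by simp
  qed
  then show ?thesis by (intro summableI_nonneg_bounded[where x=B]) auto
qed

lemma lipschitz_growth:
  fixes g :: "nat \<Rightarrow> real"
  assumes "\<And>x. \<bar>g (x + 1) - g x\<bar> \<le> 1"
  shows "\<bar>g x\<bar> \<le> \<bar>g 0\<bar> + real x"
proof (induction x)
  case (Suc x)
  then show ?case using assms[of x] by simp
qed simp

lemma summable_dominating:
  assumes "summable (\<lambda>x. pmf V x * real x)"
  shows "summable (\<lambda>x. pmf V x * (b + real x))"
proof -
  have "summable (\<lambda>x. pmf V x * b)"
    using sums_summable[OF stopped_sums[of V "\<lambda>_. b" 0]] .
  from summable_add[OF this assms] show ?thesis by (simp add: distrib_left)
qed

lemma stopped_mean_tendsto:
  fixes g :: "nat \<Rightarrow> real"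
  assumes "summable (\<lambda>x. pmf V x * real x)"
    and lip: "\<And>x. \<bar>g (x + 1) - g x\<bar> \<le> 1"
  shows "(\<lambda>n. E V (\<lambda>x. g (min x n))) \<longlonglongrightarrow> E V g"
proof -
  have limit: "(\<lambda>n. pmf V x * g (min x n)) \<longlonglongrightarrow> pmf V x * g x" for x
    by (intro tendsto_eventually eventually_sequentiallyI[of x]) (simp add: min_def)
  have bound: "norm (pmf V x * g (min x n)) \<le> pmf V x * (\<bar>g 0\<bar> + real x)" for x n
    using lipschitz_growth[of g "min x n", OF lip] by (auto simp: abs_mult intro!: mult_left_mono)
  have "((\<lambda>n. \<Sum>x. pmf V x * g (min x n)) \<longlongrightarrow> (\<Sum>x. pmf V x * g x)) sequentially"
  proof (rule tannerys_theorem[THEN conjunct2, THEN conjunct2])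
    show "\<forall>\<^sub>F (x, n) in sequentially \<times>\<^sub>F sequentially.
      norm (pmf V x * g (min x n)) \<le> pmf V x * (\<bar>g 0\<bar> + real x)"
      using bound by (intro always_eventually) auto
    show "summable (\<lambda>x. pmf V x * (\<bar>g 0\<bar> + real x))"
      using assms(1) by (rule summable_dominating)
  qed (use limit in auto)
  then show ?thesis by (simp add: E_def)
qed

text \<open>A partial sum over \<open>x < N\<close> does not see the stopping at any \<open>n \<ge> N\<close>, so the bounds for the
  stopped functions bound every partial sum in the limit.\<close>

lemma mgf_bound:
  fixes g :: "nat \<Rightarrow> real"
  assumes "c > 0" and "modified_log_sobolev V c"
    and lip: "\<And>x. \<bar>g (x + 1) - g x\<bar> \<le> 1" and "\<theta> \<ge> 0"
  shows "summable (\<lambda>x. pmf V x * exp (\<theta> * g x))"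
    and "E V (\<lambda>x. exp (\<theta> * g x)) \<le> exp (\<theta> * E V g + (exp \<theta> - 1 - \<theta>) / c)"
proof -
  let ?B = "\<lambda>m. exp (\<theta> * m + (exp \<theta> - 1 - \<theta>) / c)"
  have partial: "(\<Sum>x<N. pmf V x * exp (\<theta> * g x)) \<le> ?B (E V g)" for N
  proof (rule tendsto_lowerbound)
    show "(\<lambda>n. ?B (E V (\<lambda>x. g (min x n)))) \<longlonglongrightarrow> ?B (E V g)"
      using first_moment_finite[OF assms(1,2)] lip
      by (intro tendsto_intros stopped_mean_tendsto)
    show "\<forall>\<^sub>F n in sequentially.
      (\<Sum>x<N. pmf V x * exp (\<theta> * g x)) \<le> ?B (E V (\<lambda>x. g (min x n)))"
    proof (rule eventually_sequentiallyI[of N])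
      fix n assume "N \<le> n"
      then have "(\<Sum>x<N. pmf V x * exp (\<theta> * g x)) = (\<Sum>x<N. pmf V x * exp (\<theta> * g (min x n)))"
        by (intro sum.cong) auto
      also have "\<dots> \<le> E V (\<lambda>x. exp (\<theta> * g (min x n)))"
        unfolding E_def using sums_summable[OF stopped_sums[of V "\<lambda>i. exp (\<theta> * g i)" n]]
        by (intro sum_le_suminf) auto
      also have "\<dots> \<le> ?B (E V (\<lambda>x. g (min x n)))"
        using assms by (rule stopped_mgf_bound)
      finally show "(\<Sum>x<N. pmf V x * exp (\<theta> * g x)) \<le> ?B (E V (\<lambda>x. g (min x n)))" .
    qed
  qed simp
  show sum: "summable (\<lambda>x. pmf V x * exp (\<theta> * g x))"
    using partial by (intro summableI_nonneg_bounded[where x = "?B (E V g)"]) auto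
  show "E V (\<lambda>x. exp (\<theta> * g x)) \<le> ?B (E V g)"
    using suminf_le_const[OF sum partial] by (simp add: E_def)
qed

section \<open>Chernoff's bound\<close>

lemma chernoff_bound:
  fixes g :: "nat \<Rightarrow> real"
  assumes sum: "summable (\<lambda>x. pmf V x * exp (\<theta> * g x))" and "\<theta> \<ge> 0"
  shows "measure_pmf.prob V {x. g x \<ge> a} \<le> exp (- (\<theta> * a)) * E V (\<lambda>x. exp (\<theta> * g x))"
proof -
  let ?A = "{x. g x \<ge> a}"
  have "(\<lambda>x. pmf V x * indicator ?A x) sums measure_pmf.expectation V (indicator ?A)"
    by (intro pmf_sums_expectation measure_pmf.integrable_const_bound[where B = 1]) auto
  then have prob: "(\<lambda>x. pmf V x * indicator ?A x) sums measure_pmf.prob V ?A"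
    by simp
  have "pmf V x * indicator ?A x \<le> exp (- (\<theta> * a)) * (pmf V x * exp (\<theta> * g x))" for x
  proof -
    have "indicator ?A x \<le> exp (\<theta> * g x - \<theta> * a)"
      using \<open>\<theta> \<ge> 0\<close> by (auto simp: indicator_def mult_left_mono)
    then have "pmf V x * indicator ?A x \<le> pmf V x * exp (\<theta> * g x - \<theta> * a)"
      by (intro mult_left_mono) auto
    then show ?thesis by (simp add: exp_diff exp_minus field_simps)
  qed
  then show ?thesis
    unfolding E_def using sums_le[OF _ prob summable_sums[OF summable_mult[OF sum]]]
      suminf_mult[OF sum] by metis
qed

text \<open>The exponent \<open>\<theta> * t - (exp \<theta> - 1 - \<theta>) / c\<close> is maximal at \<open>exp \<theta> = 1 + c * t\<close>, and \<open>h (c * t) / c\<close>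
  is its maximum.\<close>

lemma tail_bound:
  fixes g :: "nat \<Rightarrow> real"
  assumes "c > 0" and "modified_log_sobolev V c"
    and lip: "\<And>x. \<bar>g (x + 1) - g x\<bar> \<le> 1" and "t \<ge> 0"
  shows "measure_pmf.prob V {x. g x \<ge> E V g + t} \<le> exp (- (h (c * t) / c))"
proof -
  define \<theta> where "\<theta> = ln (1 + c * t)"
  have "1 + c * t \<ge> 1" using \<open>c > 0\<close> \<open>t \<ge> 0\<close> by simp
  then have "\<theta> \<ge> 0" and exp_\<theta>: "exp \<theta> = 1 + c * t" by (auto simp: \<theta>_def)
  note mgf = mgf_bound[of c V g \<theta>, OF assms(1,2) lip \<open>\<theta> \<ge> 0\<close>]
  have "measure_pmf.prob V {x. g x \<ge> E V g + t}
    \<le> exp (- (\<theta> * (E V g + t))) * E V (\<lambda>x. exp (\<theta> * g x))"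
    by (rule chernoff_bound[OF mgf(1) \<open>\<theta> \<ge> 0\<close>])
  also have "\<dots> \<le> exp (- (\<theta> * (E V g + t))) * exp (\<theta> * E V g + (exp \<theta> - 1 - \<theta>) / c)"
    by (intro mult_left_mono mgf(2)) simp
  also have "\<dots> = exp (- (\<theta> * t) + (exp \<theta> - 1 - \<theta>) / c)"
    by (simp add: algebra_simps flip: exp_add)
  also have "- (\<theta> * t) + (exp \<theta> - 1 - \<theta>) / c = - (h (c * t) / c)"
    unfolding exp_\<theta> h_def \<theta>_def[symmetric] using \<open>c > 0\<close> by (simp add: field_simps)
  finally show ?thesis .
qed

theorem proposition8p1:
  fixes V :: "nat pmf" and c :: real
  assumes "c > 0"
    and "\<And>f :: nat \<Rightarrow> real. (\<And>x. f x > 0) \<Longrightarrow> summable (\<lambda>x. pmf V x * f x) \<Longrightarrow>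
      Ent V f \<le> ereal (1 / c) *
        (\<Sum>x. ereal (pmf V x * f (x + 1) * (ln (f (x + 1) / f x) - 1 + f x / f (x + 1))))"
  shows "\<forall>g :: nat \<Rightarrow> real. (SUP x. ereal \<bar>g (x + 1) - g x\<bar>) \<le> 1 \<longrightarrow>
      summable (\<lambda>x. pmf V x * \<bar>g x\<bar>) \<and>
      (\<forall>t\<ge>0. measure_pmf.prob V {x. g x \<ge> E V g + t} \<le> exp (- (h (c * t) / c)))"
proof (intro allI impI conjI)
  have lsi: "modified_log_sobolev V c"
    unfolding modified_log_sobolev_def using assms(2) by blast
  fix g :: "nat \<Rightarrow> real" assume "(SUP x. ereal \<bar>g (x + 1) - g x\<bar>) \<le> 1"
  then have lip: "\<bar>g (x + 1) - g x\<bar> \<le> 1" for x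
    by (simp add: SUP_le_iff)
  show "summable (\<lambda>x. pmf V x * \<bar>g x\<bar>)"
  proof (rule summable_comparison_test')
    show "summable (\<lambda>x. pmf V x * (\<bar>g 0\<bar> + real x))"
      by (rule summable_dominating[OF first_moment_finite[OF \<open>c > 0\<close> lsi]])
    show "norm (pmf V x * \<bar>g x\<bar>) \<le> pmf V x * (\<bar>g 0\<bar> + real x)" for x
      using lipschitz_growth[of g x, OF lip] by (auto simp: abs_mult intro!: mult_left_mono)
  qed
  show "measure_pmf.prob V {x. g x \<ge> E V g + t} \<le> exp (- (h (c * t) / c))" if "t \<ge> 0" for t
    using \<open>c > 0\<close> lsi lip that by (rule tail_bound)
qed

end
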